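(* Let $G_1$ and $G_2$ be connected semi-balanced directed graphs with $V(G_1)\cap V(G_2)=\{h,t\}$ and $E(G_1)\cap E(G_2)=\{\overrightarrow{th}\}$. Then $I_{G_1\cup G_2}=I_{G_1}\cdot I_{G_2}$.
   Context: A directed graph is an orientation of a finite graph without loops and multiple edges; $\overrightarrow{th}$ denotes an edge with tail $t$ and head $h$. Connectedness and cycles are meant in the underlying undirected graph. A cycle is semi-balanced if it has the same number of edges going in the two directions around the cycle; a directed graph is semi-balanced if all of its cycles are semi-balanced. For a directed graph $G=(V,E)$ let $\mathbf{v}\in\mathbf{R}^V$ be the standard basis vector of $v\in V$. The root polytope is $\mathcal{Q}_G=\mathrm{Conv}\{\mathbf{h}-\mathbf{t}\mid \overrightarrow{th}\in E\}\subset\mathbf{R}^V$. The interior polynomial $I_G$ of a connected semi-balanced graph $G$ is the $h^*$-polynomial of $\mathcal{Q}_G$, i.e. $I_G(t)=(1-t)^{d+1}\sum_{k=0}^\infty|(k\cdot\mathcal{Q}_G)\cap\mathbf{Z}^V|\,t^k$, where $d=\dim\mathcal{Q}_G=|V|-2$. The graph $G_1\cup G_2$ has vertex set $V(G_1)\cup V(G_2)$ and edge set $E(G_1)\cup E(G_2)$. *)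

theory Defs
  imports
    "HOL-Analysis.Analysis"
    "HOL-Computational_Algebra.Formal_Power_Series"
    "Graph_Theory.Digraph_Component"
begin

text \<open>
  An arc with tail \<open>t\<close> and head \<open>h\<close> is the pair \<open>(t, h)\<close>. Since the arcs form a set of pairs,
  repeated arcs are impossible; \<open>asym\<close> moreover forbids two opposite arcs between the same
  vertices, so that the digraph is an orientation of a finite simple graph.
\<close>

definition oriented_graph :: "'v pair_pre_digraph \<Rightarrow> bool" where
  "oriented_graph G \<longleftrightarrow> pair_digraph G \<and> asym (parcs G)"

text \<open>
  Cycles of the underlying undirected graph are cycles of its symmetric digraph, except for the
  closed walks \<open>u, v, u\<close> along a single edge, which the length condition removes.
\<close>

definition undirected_cycle :: "'v pair_pre_digraph \<Rightarrow> ('v \<times> 'v) list \<Rightarrow> bool" where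
  "undirected_cycle G p \<longleftrightarrow>
     pre_digraph.cycle (with_proj (mk_symmetric (with_proj G))) p \<and> 3 \<le> length p"

definition semi_balanced :: "'v pair_pre_digraph \<Rightarrow> bool" where
  "semi_balanced G \<longleftrightarrow>
     (\<forall>p. undirected_cycle G p \<longrightarrow>
        length (filter (\<lambda>e. e \<in> parcs G) p) =
        length (filter (\<lambda>e. prod.swap e \<in> parcs G) p))"

definition digraph_union ::
    "'v pair_pre_digraph \<Rightarrow> 'v pair_pre_digraph \<Rightarrow> 'v pair_pre_digraph" where
  "digraph_union G H = \<lparr> pverts = pverts G \<union> pverts H, parcs = parcs G \<union> parcs H \<rparr>"

lemma with_proj_digraph_union:
  "with_proj (digraph_union G H) = Digraph_Component.union (with_proj G) (with_proj H)"
  by (simp add: with_proj_def digraph_union_def Digraph_Component.union_def)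

text \<open>
  The vertex set \<open>V = pverts G\<close> may be any subset of the finite type \<open>'v\<close>. The space
  \<open>\<real>\<^sup>V\<close> is identified with the subspace of \<open>real^'v\<close> of vectors vanishing outside \<open>V\<close>. For a
  well-formed \<open>G\<close> the root polytope lies in that subspace, so neither its dimension nor the
  number of lattice points of its dilates depends on the ambient type.
\<close>

definition root_polytope :: "'v::finite pair_pre_digraph \<Rightarrow> (real^'v) set" where
  "root_polytope G = convex hull {axis h 1 - axis t 1 | t h. (t, h) \<in> parcs G}"

definition integer_points :: "(real^'v::finite) set" where
  "integer_points = {x. \<forall>v. x $ v \<in> \<int>}"

text \<open>
  The \<open>h\<^sup>*\<close>-polynomial of \<open>Q\<close>, as the formal power series
  \<open>(1 - t)\<^bsup>dim Q + 1\<^esup> * (\<Sum>k. card (k Q \<inter> \<int>\<^sup>V) t\<^sup>k)\<close>. By Ehrhart theory it has only finitely many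
  nonzero coefficients when \<open>Q\<close> is a nonempty lattice polytope. The embedding of polynomials into
  formal power series is an injective ring homomorphism, so identities between products of
  \<open>h\<^sup>*\<close>-polynomials may be read in either ring.
\<close>

definition h_star :: "(real^'v::finite) set \<Rightarrow> int fps" where
  "h_star Q = (1 - fps_X) ^ nat (aff_dim Q + 1) *
     Abs_fps (\<lambda>k. int (card ((\<lambda>x. real k *\<^sub>R x) ` Q \<inter> integer_points)))"

definition interior_polynomial :: "'v::finite pair_pre_digraph \<Rightarrow> int fps" where
  "interior_polynomial G = h_star (root_polytope G)"

end

theory Submission
  imports Defs
begin

text \<open>
  Fix an arc set with arc vectors \<open>B\<close>. Semi-balancedness provides a potential: an integer function
  on the vertices that grows by \<open>1\<close> along each arc. It induces a linear form that is \<open>1\<close> on \<open>B\<close>, so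
  the root polytope lies in a hyperplane that misses the origin, and a lattice point of its
  \<open>k\<close>-th dilate has level \<open>k\<close>. By total unimodularity of incidence matrices, the lattice points
  of the \<open>k\<close>-th dilate are exactly the \<open>k\<close>-fold sums of elements of \<open>B\<close> (\<open>lattice_points_dilate\<close>).
  The Ehrhart series is therefore the Hilbert series of the graded monoid generated by \<open>B\<close>, and
  the exponent \<open>dim Q + 1\<close> is the dimension of the span of \<open>B\<close>. All this also applies to the union:
  the two potentials, shifted to agree at \<open>t\<close>, glue to one of the union.

  Let \<open>e\<close> be the vector of the common arc and call an element \<open>x\<close> of the monoid minimal if \<open>x - e\<close>
  is not in the monoid. Since translation by \<open>e\<close> is injective and raises the level by \<open>1\<close>,
  multiplying the Hilbert series by \<open>1 - t\<close> leaves the series that counts minimal elements.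
  Now let \<open>A\<close> and \<open>B\<close> be the vectors of the two graphs. A vector in \<open>span A \<inter> span B\<close> is
  supported on the two common vertices and has coordinate sum \<open>0\<close>, hence is a multiple of \<open>e\<close>.
  Thus the decomposition of an element of the monoid of \<open>A \<union> B\<close> into an \<open>A\<close>-part and a \<open>B\<close>-part is
  unique up to moving copies of \<open>e\<close> between the parts; their number is an integer because it is a
  difference of levels. For minimal elements no copy can be moved, and addition is a level-preserving
  bijection from pairs of minimal elements to minimal elements (\<open>minimal_series_Un\<close>). So the series
  of minimal elements is multiplicative. Finally, the dimension formula gives
  \<open>dim (span (A \<union> B)) + 1 = dim (span A) + dim (span B)\<close>, which is exactly what the remaining powers
  of \<open>1 - t\<close> require.
\<close>

section \<open>Iterated sumsets\<close>

primrec sumset :: "nat \<Rightarrow> 'a::comm_monoid_add set \<Rightarrow> 'a set" where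
  "sumset 0 B = {0}"
| "sumset (Suc k) B = {b + x | b x. b \<in> B \<and> x \<in> sumset k B}"

lemma finite_sumset: "finite B \<Longrightarrow> finite (sumset k B)"
proof (induction k)
  case (Suc k)
  have "sumset (Suc k) B = (\<lambda>(b, x). b + x) ` (B \<times> sumset k B)"
    by auto
  with Suc show ?case by simp
qed simp

lemma sumset_mono: "A \<subseteq> B \<Longrightarrow> sumset k A \<subseteq> sumset k B"
  by (induction k) auto

lemma sumset_add: "x \<in> sumset i B \<Longrightarrow> y \<in> sumset j B \<Longrightarrow> x + y \<in> sumset (i + j) B"
proof (induction i arbitrary: x)
  case (Suc i)
  then obtain b x' where "b \<in> B" "x' \<in> sumset i B" "x = b + x'" by auto
  moreover have "x' + y \<in> sumset (i + j) B" using Suc calculation by blast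
  ultimately show ?case by (auto simp: add.assoc)
qed simp

lemma sumset_scaleR:
  fixes b :: "'a::real_vector"
  assumes "b \<in> B"
  shows "real n *\<^sub>R b \<in> sumset n B"
  by (induction n) (use assms in \<open>auto simp: scaleR_left_distrib\<close>)

lemma sumset_sum_scaleR:
  fixes B :: "'a::real_vector set"
  assumes "finite T" "T \<subseteq> B"
  shows "(\<Sum>b\<in>T. real (n b) *\<^sub>R b) \<in> sumset (sum n T) B"
  using assms by (induction T) (auto intro!: sumset_add sumset_scaleR)

text \<open>
  Sorting the summands by origin; a summand in \<open>A \<inter> B\<close> may go to either side, so \<open>i\<close> is not
  determined by \<open>x\<close>.
\<close>

lemma sumset_Un_split:
  assumes "x \<in> sumset k (A \<union> B)"
  obtains i y z where "i \<le> k" "y \<in> sumset i A" "z \<in> sumset (k - i) B" "x = y + z"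
proof -
  have "\<exists>i y z. i \<le> k \<and> y \<in> sumset i A \<and> z \<in> sumset (k - i) B \<and> x = y + z"
    using assms
  proof (induction k arbitrary: x)
    case (Suc k)
    then obtain b x' where b: "b \<in> A \<union> B" "x = b + x'" and "x' \<in> sumset k (A \<union> B)" by auto
    then obtain i y z where *: "i \<le> k" "y \<in> sumset i A" "z \<in> sumset (k - i) B" "x' = y + z"
      using Suc.IH by blast
    from b(1) show ?case
    proof
      assume "b \<in> A"
      with * have "b + y \<in> sumset (Suc i) A" by auto
      with * b show ?thesis
        by (intro exI[of _ "Suc i"] exI[of _ "b + y"] exI[of _ z]) (simp add: add.assoc)
    next
      assume "b \<in> B"
      with * have "b + z \<in> sumset (Suc k - i) B" by (auto simp: Suc_diff_le)
      with * b show ?thesis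
        by (intro exI[of _ i] exI[of _ y] exI[of _ "b + z"]) (simp add: add.left_commute)
    qed
  qed simp
  then show ?thesis using that by blast
qed

lemma sumset_subset_span: "sumset k B \<subseteq> span B"
  by (induction k) (auto intro: span_add span_base span_zero)

text \<open>The grading: a linear form that is \<open>1\<close> on the generators recovers the number of summands.\<close>

lemma sumset_grading:
  assumes "linear f" "\<And>b. b \<in> B \<Longrightarrow> f b = (1::real)" "x \<in> sumset k B"
  shows "f x = real k"
  using assms(3)
proof (induction k arbitrary: x)
  case 0
  then show ?case by (simp add: linear_0[OF assms(1)])
next
  case (Suc k)
  then show ?case using assms(2) by (auto simp: linear_add[OF assms(1)])
qed

section \<open>Hilbert series modulo a generator\<close>

definition sumset_series :: "'a::comm_monoid_add set \<Rightarrow> int fps" where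
  "sumset_series B = Abs_fps (\<lambda>k. int (card (sumset k B)))"

text \<open>
  These elements represent the monoid generated by \<open>B\<close> modulo translation by \<open>e\<close>. The index \<open>j\<close>
  ranges over all levels, so that the condition speaks of membership in the whole monoid and needs
  no special case at level \<open>0\<close>.
\<close>

definition minimal_sums :: "'a::ab_group_add \<Rightarrow> nat \<Rightarrow> 'a set \<Rightarrow> 'a set" where
  "minimal_sums e k B = {x \<in> sumset k B. \<forall>j. x - e \<notin> sumset j B}"

definition minimal_series :: "'a::ab_group_add \<Rightarrow> 'a set \<Rightarrow> int fps" where
  "minimal_series e B = Abs_fps (\<lambda>k. int (card (minimal_sums e k B)))"

text \<open>
  Level \<open>k + 1\<close> is the disjoint union of its minimal elements and the translate by \<open>e\<close> of level \<open>k\<close>.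
\<close>

lemma minimal_series_eq:
  fixes B :: "'a::real_vector set"
  assumes "finite B" "e \<in> B" and f: "linear f" "\<And>b. b \<in> B \<Longrightarrow> f b = (1::real)"
  shows "minimal_series e B = (1 - fps_X) * sumset_series B"
proof (rule fps_ext)
  fix n
  show "fps_nth (minimal_series e B) n = fps_nth ((1 - fps_X) * sumset_series B) n"
  proof (cases n)
    case 0
    have "0 - e \<notin> sumset j B" for j
    proof
      assume "0 - e \<in> sumset j B"
      from sumset_grading[OF f this] have "- 1 = real j"
        using assms by (simp add: linear_neg)
      then show False by simp
    qed
    then have "minimal_sums e 0 B = {0}" by (auto simp: minimal_sums_def)
    with 0 show ?thesis
      by (simp add: minimal_series_def sumset_series_def algebra_simps)
  next
    case (Suc k)
    have "sumset (Suc k) B = minimal_sums e (Suc k) B \<union> (+) e ` sumset k B"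
    proof (intro equalityI subsetI)
      fix x assume x: "x \<in> sumset (Suc k) B"
      show "x \<in> minimal_sums e (Suc k) B \<union> (+) e ` sumset k B"
      proof (cases "x \<in> minimal_sums e (Suc k) B")
        case False
        with x obtain j where j: "x - e \<in> sumset j B" by (auto simp: minimal_sums_def)
        have "real j = f (x - e)" using sumset_grading[OF f j] by simp
        also have "\<dots> = real (Suc k) - 1"
          using sumset_grading[OF f x] assms(2) f by (simp add: linear_diff)
        finally have "j = k" by simp
        with j show ?thesis by (auto simp: image_iff intro!: bexI[of _ "x - e"])
      qed simp
    qed (use assms(2) in \<open>auto simp: minimal_sums_def\<close>)
    moreover have "e + y \<notin> minimal_sums e (Suc k) B" if "y \<in> sumset k B" for y
      using that by (auto simp: minimal_sums_def simp del: sumset.simps)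
    then have "minimal_sums e (Suc k) B \<inter> (+) e ` sumset k B = {}" by blast
    ultimately have "card (sumset (Suc k) B) = card (minimal_sums e (Suc k) B) + card (sumset k B)"
      using finite_sumset[OF assms(1)]
      by (metis card_Un_disjoint card_image finite_Un inj_on_add)
    with Suc show ?thesis
      by (simp add: minimal_series_def sumset_series_def left_diff_distrib)
  qed
qed

section \<open>Two graded monoids glued along a generator\<close>

locale glued_generators =
  fixes A B :: "'a::real_vector set" and e :: 'a and f :: "'a \<Rightarrow> real"
  assumes finite_AB: "finite A" "finite B"
    and e: "e \<in> A" "e \<in> B"
    and f: "linear f" "\<And>b. b \<in> A \<union> B \<Longrightarrow> f b = 1"
    and span_Int: "span A \<inter> span B \<subseteq> span {e}"
begin

text \<open>
  The difference of two \<open>A\<close>-parts of the same element lies in both spans, hence is a multiple of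
  \<open>e\<close>; the form \<open>f\<close> identifies the factor as a difference of levels, in particular as an integer.
\<close>

lemma sum_eq_sumD:
  assumes "x + y = x' + y'" "x \<in> sumset i A" "x' \<in> sumset i' A" "y \<in> span B" "y' \<in> span B"
  shows "x = x' + (real i - real i') *\<^sub>R e" "y' = y + (real i - real i') *\<^sub>R e"
proof -
  have "x - x' = y' - y" using assms(1) by (simp add: algebra_simps)
  moreover have "x - x' \<in> span A" "y' - y \<in> span B"
    using assms sumset_subset_span by (blast intro: span_diff)+
  ultimately have "x - x' \<in> span {e}" using span_Int by auto
  then obtain a where a: "x - x' = a *\<^sub>R e" by (auto simp: span_singleton)
  have "f (x - x') = real i - real i'"
    using assms sumset_grading[OF f(1), of A] f(2) by (simp add: linear_diff[OF f(1)])
  then have "a = real i - real i'"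
    using a e f(2)[of e] by (simp add: linear_scale[OF f(1)])
  then have "x - x' = (real i - real i') *\<^sub>R e" using a by simp
  with \<open>x - x' = y' - y\<close>
  show "x = x' + (real i - real i') *\<^sub>R e" "y' = y + (real i - real i') *\<^sub>R e"
    by (metis add_diff_cancel_left' diff_add_cancel add.commute)+
qed

text \<open>
  Suppose \<open>x + y - e = s + r\<close>. Compared with \<open>(x, y)\<close>, the decomposition \<open>(s, r + e)\<close> of \<open>x + y\<close>
  differs by copies of \<open>e\<close>. If \<open>x\<close> has more of them than \<open>s\<close>, then \<open>x - e\<close> is a sum over \<open>A\<close>;
  otherwise \<open>y\<close> has at least as many as \<open>r + e\<close>, and \<open>y - e\<close> is a sum over \<open>B\<close>.
\<close>

lemma minimal_sums_add:
  assumes x: "x \<in> minimal_sums e i A" and y: "y \<in> minimal_sums e j B"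
  shows "x + y \<in> minimal_sums e (i + j) (A \<union> B)"
proof -
  have xy: "x \<in> sumset i A" "y \<in> sumset j B" using assms by (auto simp: minimal_sums_def)
  have "x \<in> sumset i (A \<union> B)" "y \<in> sumset j (A \<union> B)"
    using xy sumset_mono[of A "A \<union> B" i] sumset_mono[of B "A \<union> B" j] by auto
  then have "x + y \<in> sumset (i + j) (A \<union> B)" by (rule sumset_add)
  moreover have "x + y - e \<notin> sumset k (A \<union> B)" for k
  proof
    assume "x + y - e \<in> sumset k (A \<union> B)"
    then obtain i' s r where s: "s \<in> sumset i' A" and r: "r \<in> sumset (k - i') B"
      and sr: "x + y - e = s + r" by (rule sumset_Un_split)
    have "x + y = s + (r + e)" using sr by (simp add: algebra_simps)
    note eqs = sum_eq_sumD[OF this xy(1) s]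
    have sp: "y \<in> span B" "r + e \<in> span B"
      using xy r e sumset_subset_span by (blast intro: span_add span_base)+
    show False
    proof (cases "i' < i")
      case True
      have "x - e = s + real (i - i' - 1) *\<^sub>R e"
        using eqs(1)[OF sp] True by (simp add: algebra_simps of_nat_diff)
      also have "\<dots> \<in> sumset (i' + (i - i' - 1)) A"
        using s e by (intro sumset_add sumset_scaleR)
      finally show False using x by (auto simp: minimal_sums_def)
    next
      case False
      have "y - e = r + real (i' - i) *\<^sub>R e"
        using eqs(2)[OF sp] False by (simp add: algebra_simps of_nat_diff)
      also have "\<dots> \<in> sumset (k - i' + (i' - i)) B"
        using r e by (intro sumset_add sumset_scaleR)
      finally show False using y by (auto simp: minimal_sums_def)
    qed
  qed
  ultimately show ?thesis by (simp add: minimal_sums_def)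
qed

lemma minimal_sums_split:
  assumes "x \<in> minimal_sums e k (A \<union> B)"
  obtains i y z where "i \<le> k" "y \<in> minimal_sums e i A" "z \<in> minimal_sums e (k - i) B" "x = y + z"
proof -
  have x: "x \<in> sumset k (A \<union> B)" "\<And>j. x - e \<notin> sumset j (A \<union> B)"
    using assms by (auto simp: minimal_sums_def)
  from x(1) obtain i y z
    where *: "i \<le> k" "y \<in> sumset i A" "z \<in> sumset (k - i) B" "x = y + z"
    by (rule sumset_Un_split)
  have mono: "sumset j A \<subseteq> sumset j (A \<union> B)" "sumset j B \<subseteq> sumset j (A \<union> B)" for j
    by (simp_all add: sumset_mono)
  have "y - e \<notin> sumset j A" for j
  proof
    assume "y - e \<in> sumset j A"
    then have "(y - e) + z \<in> sumset (j + (k - i)) (A \<union> B)"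
      using *(3) mono by (blast intro: sumset_add)
    then show False using x(2) *(4) by (simp add: algebra_simps)
  qed
  moreover have "z - e \<notin> sumset j B" for j
  proof
    assume "z - e \<in> sumset j B"
    then have "y + (z - e) \<in> sumset (i + j) (A \<union> B)"
      using *(2) mono by (blast intro: sumset_add)
    then show False using x(2) *(4) by (simp add: algebra_simps)
  qed
  ultimately have "y \<in> minimal_sums e i A" "z \<in> minimal_sums e (k - i) B"
    using * by (simp_all add: minimal_sums_def)
  with * that show ?thesis by blast
qed

text \<open>
  The bijection behind the product: the parts of a minimal element are minimal, sums of minimal
  elements are minimal, and a minimal \<open>A\<close>-part cannot exceed another \<open>A\<close>-part by a positive multiple
  of \<open>e\<close>, which makes the decomposition unique.
\<close>

lemma minimal_series_Un:
  "minimal_series e (A \<union> B) = minimal_series e A * minimal_series e B"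
proof (rule fps_ext)
  fix n
  let ?P = "SIGMA i:{0..n}. minimal_sums e i A \<times> minimal_sums e (n - i) B"
  have fin: "finite (minimal_sums e k A)" "finite (minimal_sums e k B)" for k
    unfolding minimal_sums_def using finite_AB finite_sumset by (auto intro: finite_subset)
  have "bij_betw (\<lambda>(i, x, y). x + y) ?P (minimal_sums e n (A \<union> B))"
    unfolding bij_betw_def
  proof
    show "inj_on (\<lambda>(i, x, y). x + y) ?P"
    proof (rule inj_onI, clarsimp)
      fix i x y i' x' y'
      assume eq: "x + y = x' + y'"
        and x: "x \<in> minimal_sums e i A" "x' \<in> minimal_sums e i' A"
        and y: "y \<in> minimal_sums e (n - i) B" "y' \<in> minimal_sums e (n - i') B"
      have s: "x \<in> sumset i A" "x' \<in> sumset i' A" "y \<in> span B" "y' \<in> span B"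
        using x y sumset_subset_span by (auto simp: minimal_sums_def)
      (* Stated for arbitrary decompositions so that it can be applied in both directions. *)
      have *: "i \<le> i'" if "x + y = x' + y'" "x \<in> minimal_sums e i A" "x' \<in> sumset i' A"
         "y \<in> span B" "y' \<in> span B" for i i' x x' y y'
      proof (rule ccontr)
        assume "\<not> i \<le> i'"
        then have "x - e = x' + real (i - i' - 1) *\<^sub>R e"
          using sum_eq_sumD(1)[OF that(1) _ that(3-5), of i] that(2)
          by (simp add: algebra_simps of_nat_diff minimal_sums_def)
        also have "\<dots> \<in> sumset (i' + (i - i' - 1)) A"
          using that e by (intro sumset_add sumset_scaleR)
        finally show False using that(2) by (auto simp: minimal_sums_def)
      qed
      have "i = i'"
        using *[OF eq x(1) s(2-4)] *[OF eq[symmetric] x(2) s(1) s(4,3)] by simp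
      with sum_eq_sumD[OF eq s] show "i = i' \<and> x = x' \<and> y = y'" by simp
    qed
    show "(\<lambda>(i, x, y). x + y) ` ?P = minimal_sums e n (A \<union> B)"
    proof (intro equalityI subsetI)
      fix x assume "x \<in> minimal_sums e n (A \<union> B)"
      then obtain i y z where "i \<le> n" "y \<in> minimal_sums e i A" "z \<in> minimal_sums e (n - i) B"
        "x = y + z" by (rule minimal_sums_split)
      then show "x \<in> (\<lambda>(i, x, y). x + y) ` ?P"
        by (intro image_eqI[of _ _ "(i, y, z)"]) auto
    next
      fix x assume "x \<in> (\<lambda>(i, x, y). x + y) ` ?P"
      then obtain i y z where "i \<le> n" "y \<in> minimal_sums e i A" "z \<in> minimal_sums e (n - i) B"
        "x = y + z" by auto
      then show "x \<in> minimal_sums e n (A \<union> B)" using minimal_sums_add by fastforce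
    qed
  qed
  then have "card (minimal_sums e n (A \<union> B)) = card ?P"
    by (simp add: bij_betw_same_card)
  also have "\<dots> = (\<Sum>i=0..n. card (minimal_sums e i A) * card (minimal_sums e (n - i) B))"
    using fin by (simp add: card_cartesian_product)
  finally show "fps_nth (minimal_series e (A \<union> B)) n =
      fps_nth (minimal_series e A * minimal_series e B) n"
    by (simp add: minimal_series_def fps_mult_nth)
qed

lemma sumset_series_Un: "(1 - fps_X) * sumset_series (A \<union> B) =
    ((1 - fps_X) * sumset_series A) * ((1 - fps_X) * sumset_series B)"
  using minimal_series_eq[of "A \<union> B" e f] minimal_series_eq[of A e f] minimal_series_eq[of B e f]
    minimal_series_Un finite_AB e f by simp

end

section \<open>Lattice points of dilated root polytopes\<close>

text \<open>
  The bound in Caratheodory's theorem applied to a set of least cardinality whose hull contains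
  \<open>x\<close>: such a set has at most \<open>aff_dim + 1\<close> elements, which forces affine independence.
\<close>

lemma Caratheodory_affine_independent:
  fixes x :: "'a::euclidean_space"
  assumes "x \<in> convex hull B"
  obtains T where "T \<subseteq> B" "\<not> affine_dependent T" "x \<in> convex hull T"
proof -
  define P where "P T \<longleftrightarrow> finite T \<and> T \<subseteq> B \<and> x \<in> convex hull T" for T
  have "\<exists>T. P T" using assms by (auto simp: P_def caratheodory[of B])
  then obtain T where T: "P T" "\<And>U. P U \<Longrightarrow> card T \<le> card U"
    by (metis ex_has_least_nat)
  have "\<not> affine_dependent T"
  proof
    assume "affine_dependent T"
    then have "aff_dim T + 1 < int (card T)"
      using T(1) aff_dim_le_card[of T] affine_independent_iff_card[of T] by (auto simp: P_def)
    moreover obtain U where "finite U" "U \<subseteq> T" "card U \<le> aff_dim T + 1" "x \<in> convex hull U"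
      using T(1) by (auto simp: P_def caratheodory_aff_dim[of T])
    ultimately show False using T(2)[of U] T(1) by (auto simp: P_def)
  qed
  with T(1) that show ?thesis by (auto simp: P_def)
qed

text \<open>
  On the hyperplane \<open>f = 1\<close> linear and affine dependence agree, because \<open>f\<close> turns a linear
  relation into the vanishing of the sum of its coefficients.
\<close>

lemma affine_dependent_if_in_span:
  fixes T :: "'a::euclidean_space set"
  assumes "finite T" "linear f" "\<And>b. b \<in> T \<Longrightarrow> f b = (1::real)" "a \<in> T" "a \<in> span (T - {a})"
  shows "affine_dependent T"
proof -
  have "dependent T" using assms(4,5) by (auto simp: dependent_def)
  then obtain u where u: "\<exists>v\<in>T. u v \<noteq> 0" "(\<Sum>v\<in>T. u v *\<^sub>R v) = 0"
    using dependent_finite[OF assms(1)] by auto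
  have "sum u T = (\<Sum>v\<in>T. u v * f v)" using assms(3) by simp
  also have "\<dots> = f (\<Sum>v\<in>T. u v *\<^sub>R v)"
    by (simp add: linear_sum[OF assms(2)] linear_scale[OF assms(2)])
  finally have "sum u T = 0" using u(2) by (simp add: linear_0[OF assms(2)])
  with u show ?thesis using affine_dependent_explicit_finite[OF assms(1)] by blast
qed

definition arc_vector :: "'v \<times> 'v \<Rightarrow> real^'v::finite" where
  "arc_vector a = axis (snd a) 1 - axis (fst a) 1"

lemma root_polytope_eq: "root_polytope G = convex hull (arc_vector ` parcs G)"
proof -
  have "{axis h 1 - axis t 1 | t h. (t, h) \<in> parcs G} = arc_vector ` parcs G"
    by (force simp: arc_vector_def image_iff)
  then show ?thesis by (simp add: root_polytope_def)
qed

text \<open>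
  The form of total unimodularity that is needed. Let \<open>e\<close> have head \<open>h\<close> and tail \<open>t\<close>, and let \<open>K\<close> be
  the connected component of \<open>h\<close> formed by the other arcs in \<open>T\<close>. As \<open>e\<close> is not in their span,
  \<open>t\<close> is outside \<open>K\<close>, so \<open>e\<close> is the only arc that crosses the boundary of \<open>K\<close>. Summing the
  coordinates over \<open>K\<close> therefore isolates the coefficient of \<open>e\<close>. The component is described
  linearly: \<open>v \<in> K\<close> iff \<open>axis v 1 - axis h 1\<close> is in the span of the other arc vectors.
\<close>

lemma integer_coefficients:
  fixes c :: "real^'v::finite \<Rightarrow> real"
  assumes "T \<subseteq> range arc_vector" "finite T" "e \<in> T" "e \<notin> span (T - {e})"
    and int: "(\<Sum>b\<in>T. c b *\<^sub>R b) \<in> integer_points"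
  shows "c e \<in> \<int>"
proof -
  obtain t h where e: "e = axis h 1 - axis t 1" using assms(1,3) by (auto simp: arc_vector_def)
  define W where "W = span (T - {e})"
  define K where "K = {v. axis v 1 - axis h 1 \<in> W}"
  define g where "g x = (\<Sum>v\<in>K. x $ v)" for x :: "real^'v"
  have g_arc: "g (arc_vector (a, b)) = of_bool (b \<in> K) - of_bool (a \<in> K)" for a b
    by (simp add: g_def arc_vector_def axis_def sum_subtractf)
  have lin: "linear g"
    by (rule linearI) (simp_all add: g_def sum.distrib sum_distrib_left)
  have "h \<in> K" by (simp add: K_def W_def span_zero)
  moreover have "t \<notin> K"
  proof
    assume "t \<in> K"
    then have "- (axis t 1 - axis h 1) \<in> W" unfolding K_def W_def using span_neg by blast
    then show False using assms(4) e by (simp add: W_def)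
  qed
  ultimately have ge: "g e = 1" using g_arc[of t h] e by (simp add: arc_vector_def)
  have g0: "g b = 0" if b: "b \<in> T - {e}" for b
  proof -
    obtain p q where pq: "b = arc_vector (p, q)" using b assms(1) by fastforce
    have bW: "axis q 1 - axis p 1 \<in> W" using b pq by (simp add: W_def arc_vector_def span_base)
    have "q \<in> K \<longleftrightarrow> p \<in> K"
    proof
      assume "q \<in> K"
      then have "(axis q 1 - axis h 1) - (axis q 1 - axis p 1) \<in> W"
        using bW unfolding K_def W_def by (blast intro: span_diff)
      then show "p \<in> K" by (simp add: K_def)
    next
      assume "p \<in> K"
      then have "(axis p 1 - axis h 1) + (axis q 1 - axis p 1) \<in> W"
        using bW unfolding K_def W_def by (blast intro: span_add)
      then show "q \<in> K" by (simp add: K_def)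
    qed
    then show ?thesis by (simp add: pq g_arc)
  qed
  have "g (\<Sum>b\<in>T. c b *\<^sub>R b) = (\<Sum>b\<in>T. c b * g b)"
    by (simp add: linear_sum[OF lin] linear_scale[OF lin])
  also have "\<dots> = c e * g e + (\<Sum>b\<in>T - {e}. c b * g b)"
    using assms(2,3) by (simp add: sum.remove)
  also have "\<dots> = c e" using g0 ge by simp
  finally have "c e = g (\<Sum>b\<in>T. c b *\<^sub>R b)" ..
  also have "\<dots> \<in> \<int>" using int by (auto simp: g_def integer_points_def)
  finally show ?thesis .
qed

lemma sumset_arc_vectors_integer:
  assumes "B \<subseteq> range arc_vector"
  shows "sumset k B \<subseteq> integer_points"
proof (induction k)
  case (Suc k)
  have "B \<subseteq> integer_points" using assms
    by (fastforce simp: arc_vector_def integer_points_def axis_def)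
  with Suc show ?case by (fastforce simp: integer_points_def)
qed (simp add: integer_points_def)

lemma sumset_subset_dilate:
  fixes B :: "'a::real_vector set"
  assumes "B \<noteq> {}"
  shows "sumset k B \<subseteq> (\<lambda>x. real k *\<^sub>R x) ` (convex hull B)"
proof (induction k)
  case 0
  then show ?case using assms by (auto simp: image_iff)
next
  case (Suc k)
  show ?case
  proof
    fix x assume "x \<in> sumset (Suc k) B"
    then obtain b y where b: "b \<in> B" and y: "y \<in> sumset k B" and x: "x = b + y" by auto
    then obtain q where q: "q \<in> convex hull B" "y = real k *\<^sub>R q" using Suc by auto
    define r where "r = (1 / real (Suc k)) *\<^sub>R b + (real k / real (Suc k)) *\<^sub>R q"
    have "r \<in> convex hull B" unfolding r_def
      using b q by (intro convexD[OF convex_convex_hull]) (auto simp: hull_inc field_simps)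
    moreover have "x = real (Suc k) *\<^sub>R r"
      unfolding r_def x q by (simp add: scaleR_right_distrib)
    ultimately show "x \<in> (\<lambda>x. real (Suc k) *\<^sub>R x) ` (convex hull B)" by blast
  qed
qed

text \<open>
  A point of the hull is a convex combination of an affinely independent subset. After scaling by
  \<open>k\<close>, its coefficients are nonnegative integers with sum \<open>k\<close>
  by \<open>integer_coefficients\<close>. For \<open>k = 0\<close>, nonemptiness of \<open>B\<close> puts the origin into the dilate.
\<close>

lemma lattice_points_dilate:
  fixes B :: "(real^'v::finite) set"
  assumes "B \<subseteq> range arc_vector" "B \<noteq> {}" and f: "linear f" "\<And>b. b \<in> B \<Longrightarrow> f b = (1::real)"
  shows "(\<lambda>x. real k *\<^sub>R x) ` (convex hull B) \<inter> integer_points = sumset k B"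
proof
  show "sumset k B \<subseteq> (\<lambda>x. real k *\<^sub>R x) ` (convex hull B) \<inter> integer_points"
    using sumset_subset_dilate[OF assms(2)] sumset_arc_vectors_integer[OF assms(1)] by blast
  show "(\<lambda>x. real k *\<^sub>R x) ` (convex hull B) \<inter> integer_points \<subseteq> sumset k B"
  proof clarify
    fix x assume x: "x \<in> convex hull B" and int: "real k *\<^sub>R x \<in> integer_points"
    obtain T where T: "T \<subseteq> B" "\<not> affine_dependent T" "x \<in> convex hull T"
      using Caratheodory_affine_independent[OF x] .
    have fin: "finite T" using T(2) by (rule aff_independent_finite)
    obtain u where u: "\<And>b. b \<in> T \<Longrightarrow> 0 \<le> u b" "sum u T = 1" "(\<Sum>b\<in>T. u b *\<^sub>R b) = x"
      using T(3) by (auto simp: convex_hull_finite[OF fin])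
    define c where "c b = real k * u b" for b
    have cx: "(\<Sum>b\<in>T. c b *\<^sub>R b) = real k *\<^sub>R x"
      by (simp add: c_def u(3)[symmetric] scaleR_sum_right)
    have "c b \<in> \<int>" if "b \<in> T" for b
    proof (rule integer_coefficients[of T])
      show "b \<notin> span (T - {b})"
        using affine_dependent_if_in_span[OF fin f(1)] T(1,2) f(2) that by blast
    qed (use T assms fin that cx int in auto)
    then have n: "c b = real (nat \<lfloor>c b\<rfloor>)" if "b \<in> T" for b
      using that u(1) by (auto simp: c_def)
    have "real (\<Sum>b\<in>T. nat \<lfloor>c b\<rfloor>) = sum c T" using n by simp
    also have "\<dots> = real k" using u(2) by (simp add: c_def flip: sum_distrib_left)
    finally have k: "(\<Sum>b\<in>T. nat \<lfloor>c b\<rfloor>) = k" by linarith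
    have "real k *\<^sub>R x = (\<Sum>b\<in>T. real (nat \<lfloor>c b\<rfloor>) *\<^sub>R b)"
      unfolding cx[symmetric] using n by (intro sum.cong) auto
    also have "\<dots> \<in> sumset k B" using sumset_sum_scaleR[OF fin T(1), of "\<lambda>b. nat \<lfloor>c b\<rfloor>"] k by simp
    finally show "real k *\<^sub>R x \<in> sumset k B" .
  qed
qed

text \<open>The hyperplane \<open>f = 1\<close> misses the origin, so adding the origin raises the dimension by one.\<close>

lemma aff_dim_convex_hull_graded:
  fixes B :: "'a::euclidean_space set"
  assumes f: "linear f" "\<And>b. b \<in> B \<Longrightarrow> f b = (1::real)"
  shows "aff_dim (convex hull B) + 1 = int (dim (span B))"
proof -
  have "affine {x. f x = 1}"
    by (auto simp: affine_def linear_add[OF f(1)] linear_scale[OF f(1)])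
  then have "affine hull B \<subseteq> {x. f x = 1}" using f(2) by (intro hull_minimal) auto
  then have "0 \<notin> affine hull B" using linear_0[OF f(1)] by auto
  then have "aff_dim B + 1 = aff_dim (insert 0 B)" by (simp add: aff_dim_insert)
  also have "\<dots> = int (dim (insert 0 B))" by (simp add: aff_dim_zero hull_inc)
  finally show ?thesis by (simp add: dim_insert span_zero aff_dim_convex_hull)
qed

lemma h_star_convex_hull:
  fixes B :: "(real^'v::finite) set"
  assumes "B \<subseteq> range arc_vector" "B \<noteq> {}" "linear f" "\<And>b. b \<in> B \<Longrightarrow> f b = (1::real)"
  shows "h_star (convex hull B) = (1 - fps_X) ^ dim (span B) * sumset_series B"
  using aff_dim_convex_hull_graded[OF assms(3,4)] lattice_points_dilate[OF assms]
  by (simp add: h_star_def sumset_series_def)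

lemma dim_span_Un:
  fixes A B :: "'a::euclidean_space set"
  assumes "span A \<inter> span B = span {e}" "e \<noteq> 0"
  shows "dim (span (A \<union> B)) + 1 = dim (span A) + dim (span B)"
proof -
  have "span (A \<union> B) = {x + y |x y. x \<in> span A \<and> y \<in> span B}" by (rule span_Un)
  moreover have "dim (span {e}) = 1" using assms(2) by simp
  ultimately show ?thesis using dim_sums_Int[of "span A" "span B"] assms(1) by simp
qed

section \<open>Potentials of semi-balanced graphs\<close>

text \<open>
  The balance of a walk is its number of forward arcs minus its number of backward arcs. A closed
  walk splits into cycles and back-and-forth passages along a single edge, all of balance \<open>0\<close>. So
  the balance of a walk from a fixed root depends on its end only, and is the potential.
\<close>

lemma semi_balanced_potential:
  fixes G :: "'v pair_pre_digraph"
  assumes G: "oriented_graph G" "Digraph_Component.connected (with_proj G)" "semi_balanced G"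
  obtains l :: "'v \<Rightarrow> int" where "\<forall>(u, v) \<in> parcs G. l v = l u + 1"
proof -
  interpret G: pair_digraph G using G(1) by (simp add: oriented_graph_def)
  have asym: "(v, u) \<notin> parcs G" if "(u, v) \<in> parcs G" for u v
    using G(1) that by (auto simp: oriented_graph_def dest: asymD)
  define H where "H = mk_symmetric (with_proj G)"
  interpret H: pair_digraph H unfolding H_def by (rule G.digraph_mk_symmetric)
  have H: "pverts H = pverts G" "parcs H = parcs G \<union> (parcs G)\<inverse>"
    by (auto simp: H_def parcs_mk_symmetric)
  define w :: "'v \<times> 'v \<Rightarrow> int"
    where "w a = of_bool (a \<in> parcs G) - of_bool (prod.swap a \<in> parcs G)" for a
  define bal where "bal p = sum_list (map w p)" for p
  have bal_append: "bal (p @ q) = bal p + bal q" for p q by (simp add: bal_def)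
  have bal_filter: "bal p = int (length (filter (\<lambda>a. a \<in> parcs G) p)) -
      int (length (filter (\<lambda>a. prod.swap a \<in> parcs G) p))" for p
    by (induction p) (auto simp: bal_def w_def)
  (* Splitting off a closed subwalk at a repeated vertex; the first arc is put aside because the
     start of a cycle is its one permitted repetition. *)
  have closed: "bal p = 0" if "H.awalk u p u" for u p
    using that
  proof (induction "length p" arbitrary: u p rule: less_induct)
    case less
    show ?case
    proof (cases p)
      case Nil
      then show ?thesis by (simp add: bal_def)
    next
      case (Cons a as)
      with less.prems have a: "a \<in> parcs H" "fst a = u" "H.awalk (snd a) as u"
        by (auto simp: H.awalk_Cons_iff)
      show ?thesis
      proof (cases "distinct (H.awalk_verts (snd a) as)")
        case False
        obtain q r s x where as: "as = q @ r @ s" "r \<noteq> []"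
          and q: "H.awalk (snd a) q x" and r: "H.awalk x r x" and s: "H.awalk x s u"
          using H.awalk_not_distinct_decomp[OF a(3) False] by auto
        have "H.awalk u (a # q @ s) u"
          using a q s by (simp add: H.awalk_Cons_iff H.awalk_appendI del: H.awalk_append_iff)
        then have "bal (a # q @ s) = 0" using less.hyps Cons as by simp
        moreover have "bal r = 0" using less.hyps[OF _ r] Cons as by simp
        ultimately show ?thesis using Cons as by (simp add: bal_def)
      next
        case True
        then have cyc: "H.cycle p" unfolding H.cycle_def
          using less.prems Cons by (intro exI[of _ u]) (simp add: H.awalk_verts.simps)
        show ?thesis
        proof (cases "3 \<le> length p")
          case True
          then have "undirected_cycle G p" using cyc by (simp add: undirected_cycle_def H_def)
          then show ?thesis using G(3) by (simp add: semi_balanced_def bal_filter)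
        next
          case False
          (* Without loops, the remaining case is a single edge passed back and forth. *)
          then have "length p = 2"
            using cyc H.cycle_digraph_conv by fastforce
          then obtain b where as: "as = [b]" using Cons by (cases as) auto
          with a have "b = prod.swap a"
            by (cases a; cases b) (auto simp: H.awalk_Cons_iff H.awalk_Nil_iff)
          then show ?thesis by (simp add: Cons as bal_def w_def)
        qed
      qed
    qed
  qed
  have conn: "\<exists>p. H.awalk u p v" if "u \<in> pverts G" "v \<in> pverts G" for u v
    using G(2) that H H.reachable_awalk
    by (auto simp: Digraph_Component.connected_def strongly_connected_def H_def)
  obtain r where r: "r \<in> pverts G"
    using G(2) by (auto simp: Digraph_Component.connected_def strongly_connected_def)
  define l where "l v = bal (SOME p. H.awalk r p v)" for v
  have l: "l v = bal p" if p: "H.awalk r p v" for v p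
  proof -
    have q: "H.awalk r (SOME p. H.awalk r p v) v" (is "H.awalk r ?q v") using p by (rule someI)
    have "v \<in> pverts G" using p H(1) by auto
    (* Two walks from r to v become closed by the same walk back, so their balances agree. *)
    then obtain s where s: "H.awalk v s r" using conn r by blast
    have "bal (p @ s) = 0" "bal (?q @ s) = 0"
      using H.awalk_appendI[OF p s] H.awalk_appendI[OF q s] closed by blast+
    then show ?thesis by (simp add: l_def bal_append)
  qed
  have "l v = l u + 1" if uv: "(u, v) \<in> parcs G" for u v
  proof -
    have "u \<in> pverts G" using uv G.in_arcsD1 by auto
    then obtain p where p: "H.awalk r p u" using conn r by blast
    moreover have "H.awalk u [(u, v)] v"
      using uv H by (auto simp: H.awalk_Cons_iff H.awalk_Nil_iff G.in_arcsD1 G.in_arcsD2)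
    ultimately have "H.awalk r (p @ [(u, v)]) v" by (rule H.awalk_appendI)
    then have "l v = bal (p @ [(u, v)])" by (rule l)
    then have "l v = bal p + w (u, v)" by (simp add: bal_def)
    then show ?thesis using l[OF p] uv asym by (simp add: w_def)
  qed
  with that show ?thesis by blast
qed

section \<open>Gluing along an arc\<close>

definition potential_form :: "('v \<Rightarrow> int) \<Rightarrow> real^'v::finite \<Rightarrow> real" where
  "potential_form l x = (\<Sum>v\<in>UNIV. of_int (l v) * x $ v)"

lemma linear_potential_form: "linear (potential_form l)"
  by (rule linearI) (simp_all add: potential_form_def sum.distrib distrib_left sum_distrib_left
      mult.left_commute)

lemma potential_form_arc_vector: "potential_form l (arc_vector (u, v)) = of_int (l v - l u)"
proof -
  have "potential_form l (axis w 1) = of_int (l w)" for w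
    by (simp add: potential_form_def axis_def if_distrib cong: if_cong)
  then show ?thesis
    by (simp add: arc_vector_def linear_diff[OF linear_potential_form])
qed

lemma span_arc_vectors_support:
  assumes "A \<subseteq> V \<times> V" "x \<in> span (arc_vector ` A)"
  shows "(\<Sum>v\<in>UNIV. x $ v) = 0" "v \<notin> V \<Longrightarrow> x $ v = 0"
proof -
  let ?S = "{x. (\<Sum>v\<in>UNIV. x $ v) = 0 \<and> (\<forall>v. v \<notin> V \<longrightarrow> x $ v = 0)}"
  have "subspace ?S"
    by (auto simp: subspace_def sum.distrib simp flip: scaleR_sum_right)
  moreover have "arc_vector ` A \<subseteq> ?S"
    using assms(1) by (auto simp: arc_vector_def axis_def sum_subtractf)
  ultimately have "x \<in> ?S" using assms(2) span_minimal by blast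
  then show "(\<Sum>v\<in>UNIV. x $ v) = 0" "v \<notin> V \<Longrightarrow> x $ v = 0" by auto
qed

text \<open>
  Vectors in both spans live on the two common vertices, where vanishing of the coordinate sum
  leaves a line.
\<close>

lemma span_arc_vectors_Int:
  fixes h t :: "'v::finite"
  assumes "A \<subseteq> V \<times> V" "B \<subseteq> W \<times> W" "V \<inter> W = {h, t}" "(t, h) \<in> A" "(t, h) \<in> B" "h \<noteq> t"
  shows "span (arc_vector ` A) \<inter> span (arc_vector ` B) = span {arc_vector (t, h)}"
proof
  show "span {arc_vector (t, h)} \<subseteq> span (arc_vector ` A) \<inter> span (arc_vector ` B)"
    using assms(4,5) by (intro Int_greatest span_mono) auto
  show "span (arc_vector ` A) \<inter> span (arc_vector ` B) \<subseteq> span {arc_vector (t, h)}"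
  proof
    fix x assume x: "x \<in> span (arc_vector ` A) \<inter> span (arc_vector ` B)"
    have 0: "x $ v = 0" if "v \<notin> {h, t}" for v
      using x that assms(3) span_arc_vectors_support(2)[OF assms(1), of x v]
        span_arc_vectors_support(2)[OF assms(2), of x v] by auto
    have "0 = (\<Sum>v\<in>UNIV. x $ v)" using x span_arc_vectors_support(1)[OF assms(1)] by simp
    also have "\<dots> = (\<Sum>v\<in>{h, t}. x $ v)" using 0 by (intro sum.mono_neutral_right) auto
    finally have "x $ t = - x $ h" using assms(6) by simp
    then have "x = x $ h *\<^sub>R arc_vector (t, h)"
      using 0 assms(6) by (auto simp: vec_eq_iff arc_vector_def axis_def)
    then show "x \<in> span {arc_vector (t, h)}" by (metis span_base span_scale singletonI)
  qed
qed

theorem proposition11p1: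
  fixes G\<^sub>1 G\<^sub>2 :: "'v::finite pair_pre_digraph" and h t :: 'v
  assumes "oriented_graph G\<^sub>1" and "oriented_graph G\<^sub>2"
    and "Digraph_Component.connected (with_proj G\<^sub>1)"
    and "Digraph_Component.connected (with_proj G\<^sub>2)"
    and "semi_balanced G\<^sub>1" and "semi_balanced G\<^sub>2"
    and "pverts G\<^sub>1 \<inter> pverts G\<^sub>2 = {h, t}"
    and "parcs G\<^sub>1 \<inter> parcs G\<^sub>2 = {(t, h)}"
  shows "interior_polynomial (digraph_union G\<^sub>1 G\<^sub>2) =
         interior_polynomial G\<^sub>1 * interior_polynomial G\<^sub>2"
proof -
  interpret G1: pair_digraph G\<^sub>1 using assms(1) by (simp add: oriented_graph_def)
  interpret G2: pair_digraph G\<^sub>2 using assms(2) by (simp add: oriented_graph_def)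
  have arcs: "parcs G\<^sub>1 \<subseteq> pverts G\<^sub>1 \<times> pverts G\<^sub>1" "parcs G\<^sub>2 \<subseteq> pverts G\<^sub>2 \<times> pverts G\<^sub>2"
    using G1.wellformed' G2.wellformed' by auto
  have th: "(t, h) \<in> parcs G\<^sub>1" "(t, h) \<in> parcs G\<^sub>2" "h \<noteq> t"
    using assms(8) G1.pair_no_loops[of "(t, h)"] by auto
  obtain l1 :: "'v \<Rightarrow> int" where l1: "\<forall>(u, v) \<in> parcs G\<^sub>1. l1 v = l1 u + 1"
    using semi_balanced_potential[OF assms(1,3,5)] by blast
  obtain l2 :: "'v \<Rightarrow> int" where l2: "\<forall>(u, v) \<in> parcs G\<^sub>2. l2 v = l2 u + 1"
    using semi_balanced_potential[OF assms(2,4,6)] by blast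
  have th_1: "l1 h = l1 t + 1" "l2 h = l2 t + 1" using l1 l2 th by auto
  (* A potential stays one after adding a constant. The shift makes the two potentials agree at
     t, and then also at h, since both grow by 1 along the common arc. *)
  define l where "l v = (if v \<in> pverts G\<^sub>1 then l1 v else l2 v - l2 t + l1 t)" for v
  have l_2: "l v = l2 v - l2 t + l1 t" if "v \<in> pverts G\<^sub>2" for v
  proof -
    have "v \<in> pverts G\<^sub>1 \<Longrightarrow> v = h \<or> v = t" using that assms(7) by blast
    then show ?thesis using th_1 by (auto simp: l_def)
  qed
  have l: "l v = l u + 1" if "(u, v) \<in> parcs G\<^sub>1 \<union> parcs G\<^sub>2" for u v
  proof (cases "(u, v) \<in> parcs G\<^sub>1")
    case True
    then show ?thesis using l1 arcs(1) by (auto simp: l_def)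
  next
    case False
    then have uv: "(u, v) \<in> parcs G\<^sub>2" using that by auto
    then have "u \<in> pverts G\<^sub>2" "v \<in> pverts G\<^sub>2" "l2 v = l2 u + 1" using arcs(2) l2 by auto
    then show ?thesis using l_2 by simp
  qed
  define A B where "A = arc_vector ` parcs G\<^sub>1" and "B = arc_vector ` parcs G\<^sub>2"
  define e where "e = arc_vector (t, h)"
  define f where "f = potential_form l"
  have f_arc: "f (arc_vector a) = 1" if "a \<in> parcs G\<^sub>1 \<union> parcs G\<^sub>2" for a
  proof (cases a)
    case (Pair u v)
    then have "l v = l u + 1" using l that by blast
    then show ?thesis by (simp add: Pair f_def potential_form_arc_vector)
  qed
  have f: "linear f" "\<And>b. b \<in> A \<union> B \<Longrightarrow> f b = 1"
    using f_arc by (auto simp: f_def A_def B_def linear_potential_form)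
  have e: "e \<in> A" "e \<in> B" using th by (auto simp: A_def B_def e_def)
  have "e \<noteq> 0" using f e linear_0[OF f(1)] by force
  have Int: "span A \<inter> span B = span {e}"
    unfolding A_def B_def e_def using arcs assms(7) th by (rule span_arc_vectors_Int)
  interpret glued_generators A B e f
    by (rule glued_generators.intro) (use f e Int in \<open>auto simp: A_def B_def\<close>)
  have poly: "interior_polynomial G\<^sub>1 = h_star (convex hull A)"
    "interior_polynomial G\<^sub>2 = h_star (convex hull B)"
    "interior_polynomial (digraph_union G\<^sub>1 G\<^sub>2) = h_star (convex hull (A \<union> B))"
    by (simp_all add: interior_polynomial_def root_polytope_eq digraph_union_def A_def B_def image_Un)
  have hs: "h_star (convex hull C) = (1 - fps_X) ^ dim (span C) * sumset_series C"
    if "C \<in> {A, B, A \<union> B}" for C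
    using that e f by (intro h_star_convex_hull[of _ f]) (auto simp: A_def B_def)
  obtain a where a: "dim (span A) = Suc a"
    using \<open>e \<noteq> 0\<close> e by (metis dim_eq_0 dim_span not0_implies_Suc singletonD subsetD)
  obtain b where b: "dim (span B) = Suc b"
    using \<open>e \<noteq> 0\<close> e by (metis dim_eq_0 dim_span not0_implies_Suc singletonD subsetD)
  have d: "dim (span (A \<union> B)) = Suc (a + b)"
    using dim_span_Un[OF Int \<open>e \<noteq> 0\<close>] a b by simp
  have "interior_polynomial (digraph_union G\<^sub>1 G\<^sub>2) =
      (1 - fps_X) ^ (a + b) * ((1 - fps_X) * sumset_series (A \<union> B))"
    unfolding poly using hs[of "A \<union> B"] d by (simp add: mult_ac)
  also have "\<dots> = ((1 - fps_X) ^ Suc a * sumset_series A) * ((1 - fps_X) ^ Suc b * sumset_series B)"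
    unfolding sumset_series_Un by (simp add: power_add mult_ac)
  also have "\<dots> = interior_polynomial G\<^sub>1 * interior_polynomial G\<^sub>2"
    unfolding poly using hs a b by simp
  finally show ?thesis .
qed

end
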